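(* Let $(Y,\mathbf{X})$ be a $(d+1)$-dimensional random vector such that the distribution function $F_Y$ of $Y$ is continuous. The following statements are equivalent: (i) There exists $t\in(0,1]$ such that $\kappa_{(Y,\mathbf{X})}(t)=1$. (ii) $Y$ is perfectly dependent on $\mathbf{X}$, i.e. there exists a measurable function $f:\mathbb{R}^d\to\mathbb{R}$ such that $Y=f(\mathbf{X})$ almost surely.
   Context: $Y$ is real-valued and $\mathbf{X}$ takes values in $\mathbb{R}^d$, $d\ge 1$. $Y'$ is a random variable (on a possibly extended probability space) such that, conditionally on $\mathbf{X}$, $Y$ and $Y'$ are independent and identically distributed, i.e. $\mathbb{P}(Y\in A, Y'\in B\mid \mathbf{X})=\mathbb{P}(Y\in A\mid\mathbf{X})\,\mathbb{P}(Y\in B\mid\mathbf{X})$ almost surely for all Borel sets $A,B\subseteq\mathbb{R}$. For $t\in[0,1]$, $$\phi_{(Y,\mathbf{X})}(t):=\mathbb{P}\bigl(|F_Y(Y)-F_Y(Y')|\le t\bigr),\qquad \kappa_{(Y,\mathbf{X})}(t):=1-3\int_0^t\bigl(1-\phi_{(Y,\mathbf{X})}(s)\bigr)\,\mathrm{d}s.$$ *)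

theory Defs
  imports "HOL-Probability.Probability"
begin

text \<open>A version of \<open>P(E | X)\<close>: the conditional expectation of the indicator of \<open>E\<close> given the
  sigma-algebra generated by \<open>X\<close>.\<close>

definition prob_given ::
  "'a measure \<Rightarrow> ('a \<Rightarrow> 'c::topological_space) \<Rightarrow> 'a set \<Rightarrow> 'a \<Rightarrow> real" where
  "prob_given N X E =
     real_cond_exp N (vimage_algebra (space N) X borel) (indicator E)"

text \<open>\<^const>\<open>real_cond_exp\<close> is \<open>0\<close> by convention when its second argument is not a sigma-finite
  subalgebra; that case does not arise here.\<close>

lemma sigma_finite_subalgebra_vimage_borel:
  assumes "prob_space N" "X \<in> borel_measurable N"
  shows "sigma_finite_subalgebra N (vimage_algebra (space N) X borel)"
proof -
  interpret prob_space N by fact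
  have "subalgebra N (vimage_algebra (space N) X borel)"
    using assms(2) by (auto simp: subalgebra_def sets_vimage_algebra2 measurable_def)
  then interpret finite_measure_subalgebra N "vimage_algebra (space N) X borel"
    by unfold_locales
  show ?thesis by (rule sigma_finite_subalgebra_axioms)
qed

definition cond_iid_given ::
  "'a measure \<Rightarrow> ('a \<Rightarrow> 'c::topological_space) \<Rightarrow> ('a \<Rightarrow> real) \<Rightarrow> ('a \<Rightarrow> real) \<Rightarrow> bool" where
  "cond_iid_given N X Y Y' \<longleftrightarrow>
     (\<forall>A\<in>sets borel. \<forall>B\<in>sets borel. AE \<omega> in N.
        prob_given N X {\<omega> \<in> space N. Y \<omega> \<in> A \<and> Y' \<omega> \<in> B} \<omega> =
        prob_given N X {\<omega> \<in> space N. Y \<omega> \<in> A} \<omega> * prob_given N X {\<omega> \<in> space N. Y \<omega> \<in> B} \<omega>)"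

text \<open>\<open>N\<close> is an extension of the probability space \<open>M\<close>, with projection \<open>p\<close> onto \<open>M\<close>; a random
  variable \<open>Z\<close> on \<open>M\<close> becomes \<open>Z \<circ> p\<close> on \<open>N\<close>. The case \<open>N = M\<close>, \<open>p = id\<close> is included.\<close>

definition prob_extension :: "'a measure \<Rightarrow> 'b measure \<Rightarrow> ('b \<Rightarrow> 'a) \<Rightarrow> bool" where
  "prob_extension M N p \<longleftrightarrow> prob_space N \<and> p \<in> measurable N M \<and> distr N M p = M"

text \<open>\<open>Y'\<close>, living on the extension \<open>N\<close> of \<open>M\<close>, is a copy of \<open>Y\<close> that is conditionally
  independent of \<open>Y\<close> and identically distributed given \<open>X\<close>.\<close>

definition cond_iid_copy ::
  "'a measure \<Rightarrow> ('a \<Rightarrow> 'c::topological_space) \<Rightarrow> ('a \<Rightarrow> real) \<Rightarrow>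
   'b measure \<Rightarrow> ('b \<Rightarrow> 'a) \<Rightarrow> ('b \<Rightarrow> real) \<Rightarrow> bool" where
  "cond_iid_copy M X Y N p Y' \<longleftrightarrow>
     prob_extension M N p \<and> Y' \<in> borel_measurable N \<and>
     cond_iid_given N (X \<circ> p) (Y \<circ> p) Y'"

text \<open>The dependence of \<open>\<phi>\<close> and \<open>\<kappa>\<close> on \<open>X\<close> enters through the joint law of \<open>(Y \<circ> p, Y')\<close>
  on \<open>N\<close>; \<open>F\<^sub>Y\<close> is the distribution function of \<open>Y\<close> on \<open>M\<close>.\<close>

definition phi ::
  "'a measure \<Rightarrow> ('a \<Rightarrow> real) \<Rightarrow> 'b measure \<Rightarrow> ('b \<Rightarrow> 'a) \<Rightarrow> ('b \<Rightarrow> real) \<Rightarrow> real \<Rightarrow> real" where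
  "phi M Y N p Y' t =
     (let F = cdf (distr M borel Y)
      in measure N {\<omega> \<in> space N. \<bar>F (Y (p \<omega>)) - F (Y' \<omega>)\<bar> \<le> t})"

definition kappa ::
  "'a measure \<Rightarrow> ('a \<Rightarrow> real) \<Rightarrow> 'b measure \<Rightarrow> ('b \<Rightarrow> 'a) \<Rightarrow> ('b \<Rightarrow> real) \<Rightarrow> real \<Rightarrow> real" where
  "kappa M Y N p Y' t = 1 - 3 * (LINT s:{0..t}|lborel. 1 - phi M Y N p Y' s)"

definition perfectly_dependent ::
  "'a measure \<Rightarrow> ('a \<Rightarrow> 'c::topological_space) \<Rightarrow> ('a \<Rightarrow> real) \<Rightarrow> bool" where
  "perfectly_dependent M X Y \<longleftrightarrow>
     (\<exists>f \<in> borel_measurable borel. AE \<omega> in M. Y \<omega> = f (X \<omega>))"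

end

theory Submission
  imports Defs
begin

text \<open>
  Write \<open>F\<close> for the distribution function of \<open>Y\<close>, and \<open>W = X \<circ> p\<close>, \<open>Z = Y \<circ> p\<close> for \<open>X\<close> and \<open>Y\<close>
  on the extended space. Since \<open>\<kappa>(t) = 1 - 3 \<integral>\<^sub>0\<^sup>t P(D > s) ds\<close> with \<open>D = \<bar>F(Z) - F(Y')\<bar> \<ge> 0\<close>, the equation
  \<open>\<kappa>(t) = 1\<close> for a single \<open>t > 0\<close> already forces \<open>D = 0\<close> almost surely, because \<open>s \<mapsto> P(D > s)\<close> is
  nonnegative and decreasing (lemma \<open>integral_tail_eq_0_iff\<close>). So the claim is that
  \<open>F(Z) = F(Y')\<close> almost surely if and only if \<open>Z\<close> is almost surely a function of \<open>W\<close>.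

  Suppose \<open>F(Z) = F(Y')\<close>, fix \<open>r\<close> and let \<open>A = {y. F y \<le> F r}\<close>. The events \<open>Z \<in> A\<close> and \<open>Y' \<in> A\<close>
  coincide, so \<open>q = P(Z \<in> A | W)\<close> satisfies \<open>q = P(Z \<in> A, Y' \<in> A | W) = q\<^sup>2\<close>. A conditional
  probability with values in \<open>{0, 1}\<close> is the indicator of its event, so this event is, up to a null
  set, of the form \<open>W \<in> C\<close> (lemma \<open>indicator_real_cond_exp_idempotent\<close>). Continuity of \<open>F\<close> makes
  \<open>Z \<in> A\<close> the same as \<open>Z \<le> r\<close> almost surely (lemma \<open>AE_cdf_le_iff\<close>). Hence all events \<open>Z \<le> r\<close>
  with rational \<open>r\<close> are determined by \<open>W\<close>, and \<open>Z\<close> is recovered as the infimum of the \<open>r\<close> with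
  \<open>Z \<le> r\<close> (lemma \<open>AE_eq_function_if_levels_determined\<close>).

  Conversely, if \<open>Z = f(W)\<close>, then for disjoint \<open>A\<close> and \<open>B\<close> the conditional probability
  \<open>P(Z \<in> A, Y' \<in> B | W)\<close> is the product of the indicators of \<open>f(W) \<in> A\<close> and \<open>f(W) \<in> B\<close>, which is
  zero. No half-line thus separates \<open>Z\<close> from \<open>Y'\<close>, so \<open>Z = Y'\<close> almost surely.
\<close>

section \<open>Integrated tails\<close>

text \<open>If \<open>P(D > e)\<close> were positive for some \<open>e \<in> (0, t]\<close>, monotonicity would bound the integral below by
  \<open>e P(D > e)\<close>.\<close>

lemma (in prob_space) integral_tail_eq_0_iff:
  fixes D :: "'a \<Rightarrow> real"
  assumes D: "D \<in> borel_measurable M" and nonneg: "\<And>x. x \<in> space M \<Longrightarrow> D x \<ge> 0" and t: "t > 0"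
  shows "(LINT s:{0..t}|lborel. 1 - prob {x \<in> space M. D x \<le> s}) = 0 \<longleftrightarrow> (AE x in M. D x = 0)"
proof
  let ?\<phi> = "\<lambda>s. prob {x \<in> space M. D x \<le> s}"
  have sets[measurable]: "{x \<in> space M. D x \<le> s} \<in> events" for s
    using D by measurable
  have mono: "mono ?\<phi>"
    by (intro monoI finite_measure_mono) auto
  have [measurable]: "?\<phi> \<in> borel_measurable borel"
    using borel_measurable_mono[OF mono] .
  have int: "set_integrable lborel {0..t} (\<lambda>s. 1 - ?\<phi> s)"
    unfolding set_integrable_def
    by (rule integrableI_bounded_set_indicator[where B=1]) (auto simp: prob_le_1 emeasure_lborel_Icc_eq)
  {
    assume zero: "(LINT s:{0..t}|lborel. 1 - ?\<phi> s) = 0"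
    have full: "?\<phi> e = 1" if e: "0 < e" "e \<le> t" for e
    proof -
      have "e * (1 - ?\<phi> e) = (\<integral>s. indicator {0..e} s *\<^sub>R (1 - ?\<phi> e) \<partial>lborel)"
        using e by simp
      also have "\<dots> \<le> (LINT s:{0..t}|lborel. 1 - ?\<phi> s)"
        unfolding set_lebesgue_integral_def
      proof (rule integral_mono)
        show "integrable lborel (\<lambda>s. indicator {0..e} s *\<^sub>R (1 - ?\<phi> e))"
          by (rule integrableI_bounded_set_indicator[where B=1])
            (auto simp: prob_le_1 emeasure_lborel_Icc_eq)
        show "integrable lborel (\<lambda>s. indicator {0..t} s *\<^sub>R (1 - ?\<phi> s))"
          using int by (simp add: set_integrable_def)
        show "indicator {0..e} s *\<^sub>R (1 - ?\<phi> e) \<le> indicator {0..t} s *\<^sub>R (1 - ?\<phi> s)" for s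
          using monoD[OF mono, of s e] e by (auto simp: indicator_def prob_le_1)
      qed
      finally have "e * (1 - ?\<phi> e) \<le> 0"
        using zero by simp
      then have "1 \<le> ?\<phi> e"
        using e by (simp add: mult_le_0_iff)
      then show ?thesis
        using prob_le_1 by (intro antisym) auto
    qed
    have "AE x in M. D x \<le> min t (1 / Suc n)" for n
    proof -
      have "?\<phi> (min t (1 / Suc n)) = 1"
        using t by (intro full) auto
      then show ?thesis
        using prob_Collect_eq_1[OF sets] by blast
    qed
    then have "AE x in M. \<forall>n. D x \<le> min t (1 / Suc n)"
      by (simp add: AE_all_countable)
    with AE_space show "AE x in M. D x = 0"
    proof eventually_elim
      case (elim x)
      then have "\<not> 0 < D x"
        by (metis min.bounded_iff not_less reals_Archimedean inverse_eq_divide)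
      then show ?case
        using nonneg[OF elim(1)] by simp
    qed
  }
  {
    assume zero: "AE x in M. D x = 0"
    have "?\<phi> s = 1" if "s \<ge> 0" for s
      using zero that by (subst prob_Collect_eq_1) (auto simp: D elim: eventually_mono)
    then have "(LINT s:{0..t}|lborel. 1 - ?\<phi> s) = (LINT s:{0..t}|lborel. 0)"
      by (intro set_lebesgue_integral_cong) auto
    then show "(LINT s:{0..t}|lborel. 1 - ?\<phi> s) = 0"
      by simp
  }
qed

section \<open>Level sets of a continuous distribution function\<close>

text \<open>The points \<open>y > r\<close> with \<open>F y \<le> F r\<close> form the part beyond \<open>r\<close> of a plateau of \<open>F\<close>. Continuity
  includes the right end of the plateau, so the exceptional set is an interval on which \<open>F\<close> does not
  increase, hence a null set.\<close>

lemma (in real_distribution) AE_cdf_le_iff: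
  assumes cont: "continuous_on UNIV (cdf M)"
  shows "AE y in M. cdf M y \<le> cdf M r \<longleftrightarrow> y \<le> r"
proof -
  define S where "S = {y. cdf M y = cdf M r}"
  have null: "{r<..y} \<in> null_sets M" if "cdf M y \<le> cdf M r" for y
  proof (cases "r < y")
    case True
    then have "measure M {r<..y} = 0"
      using that by (metis cdf_diff_eq cdf_nondecreasing antisym less_imp_le diff_self)
    then show ?thesis
      by (simp add: null_sets_def emeasure_eq_measure)
  qed auto
  have "\<exists>Q \<in> null_sets M. S \<inter> {r<..} \<subseteq> Q"
  proof (cases "bdd_above S")
    case True
    have "closed S"
      unfolding S_def using continuous_closed_preimage_constant[OF cont] by simp
    moreover have "r \<in> S"
      by (simp add: S_def)
    ultimately have "Sup S \<in> S"
      using True closed_contains_Sup by blast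
    then have "{r<..Sup S} \<in> null_sets M"
      using null by (simp add: S_def)
    then show ?thesis
      using cSup_upper[OF _ True] by (intro bexI) auto
  next
    case False
    have "cdf M (real n) \<le> cdf M r" for n
    proof -
      obtain y where "y \<in> S" "real n < y"
        using False by (metis bdd_above.I not_le)
      then show ?thesis
        using cdf_nondecreasing[of "real n" y] by (simp add: S_def)
    qed
    then have "(\<Union>n. {r<..real n}) \<in> null_sets M"
      using null by blast
    moreover have "S \<inter> {r<..} \<subseteq> (\<Union>n. {r<..real n})"
      using real_arch_simple by auto
    ultimately show ?thesis
      by blast
  qed
  then obtain Q where "Q \<in> null_sets M" "S \<inter> {r<..} \<subseteq> Q"
    by blast
  from AE_not_in[OF this(1)] show ?thesis
  proof eventually_elim
    case (elim y)
    have "y \<le> r" if "cdf M y \<le> cdf M r"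
    proof (rule ccontr)
      assume "\<not> y \<le> r"
      then have "cdf M y = cdf M r"
        using that cdf_nondecreasing[of r y] by simp
      then show False
        using elim \<open>S \<inter> {r<..} \<subseteq> Q\<close> \<open>\<not> y \<le> r\<close> by (auto simp: S_def)
    qed
    then show ?case
      using cdf_nondecreasing by blast
  qed
qed

section \<open>Events and variables determined by a sub-sigma-algebra\<close>

text \<open>With \<open>q = P(E | G)\<close> and \<open>B = {q = 1}\<close>, the hypothesis makes \<open>q\<close> the indicator of \<open>B\<close>. Integrating
  \<open>q\<close> over the whole space and over \<open>B\<close> gives \<open>P(E) = P(B) = P(E \<inter> B)\<close>.\<close>

lemma (in finite_measure_subalgebra) indicator_real_cond_exp_idempotent:
  assumes E: "E \<in> sets M"
    and idem: "AE x in M. real_cond_exp M F (indicator E) x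
                 = real_cond_exp M F (indicator E) x * real_cond_exp M F (indicator E) x"
  shows "\<exists>B \<in> sets F. AE x in M. x \<in> E \<longleftrightarrow> x \<in> B"
proof -
  define q where "q = real_cond_exp M F (indicator E)"
  define B where "B = {x \<in> space F. q x = 1}"
  have [measurable]: "q \<in> borel_measurable F"
    by (simp add: q_def)
  have BF: "B \<in> sets F"
    unfolding B_def by measurable
  then have BM: "B \<in> sets M"
    using subalg by (auto simp: subalgebra_def)
  have sp: "space F = space M"
    using subalg by (simp add: subalgebra_def)
  have qB: "AE x in M. q x = indicator B x"
    using idem AE_space by eventually_elim (auto simp: q_def[symmetric] B_def sp indicator_def)
  have qM[measurable]: "q \<in> borel_measurable M"
    by (simp add: q_def)
  have intE: "integrable M (indicator E :: _ \<Rightarrow> real)"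
    using E by (intro integrable_real_indicator) (auto simp: less_top[symmetric])
  have "measure M E = (\<integral>x. q x \<partial>M)"
    unfolding q_def using real_cond_exp_int(2)[OF intE] E by simp
  also have "\<dots> = (\<integral>x. indicator B x \<partial>M)"
    using qB BM by (intro integral_cong_AE) auto
  finally have 1: "measure M E = measure M B"
    using BM by simp
  have "measure M (E \<inter> B) = (\<integral>x\<in>B. indicator E x \<partial>M)"
    using E BM by (simp add: set_lebesgue_integral_def indicator_inter_arith[symmetric] Int_commute)
  also have "\<dots> = (\<integral>x\<in>B. q x \<partial>M)"
    unfolding q_def by (rule real_cond_exp_intA[OF intE BF])
  also have "\<dots> = (\<integral>x. indicator B x \<partial>M)"
    unfolding set_lebesgue_integral_def using qB BM
    by (intro integral_cong_AE) (auto elim!: eventually_mono simp: indicator_def)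
  finally have 2: "measure M (E \<inter> B) = measure M B"
    using BM by simp
  have "measure M (E - B) = 0" "measure M (B - E) = 0"
    using finite_measure_Diff'[of E B] finite_measure_Diff'[of B E] E BM 1 2 by (auto simp: Int_commute)
  then have "E - B \<in> null_sets M" "B - E \<in> null_sets M"
    using E BM by (auto simp: null_sets_def emeasure_eq_measure)
  from this[THEN AE_not_in] have "AE x in M. x \<in> E \<longleftrightarrow> x \<in> B"
    by eventually_elim auto
  then show ?thesis
    using BF by blast
qed

lemma AE_eq_function_if_levels_determined:
  fixes Z :: "'a \<Rightarrow> real" and W :: "'a \<Rightarrow> 'c"
  assumes det: "\<And>r::rat. \<exists>C \<in> sets L. AE x in M. Z x \<le> of_rat r \<longleftrightarrow> W x \<in> C"
  shows "\<exists>f \<in> borel_measurable L. AE x in M. Z x = f (W x)"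
proof -
  from det obtain C where C[measurable]: "\<And>r. C r \<in> sets L"
    and CZ: "\<And>r. AE x in M. Z x \<le> real_of_rat r \<longleftrightarrow> W x \<in> C r"
    by metis
  (* The infimum is infinite when w lies in no C r or in every C r; real_of_ereal then gives 0,
     which does no harm because almost surely W avoids such w. *)
  define f where "f w = real_of_ereal (INF r. if w \<in> C r then ereal (real_of_rat r) else \<infinity>)" for w
  have "f \<in> borel_measurable L"
    unfolding f_def by measurable
  moreover have "AE x in M. \<forall>r. Z x \<le> real_of_rat r \<longleftrightarrow> W x \<in> C r"
    using CZ by (simp add: AE_all_countable)
  then have "AE x in M. Z x = f (W x)"
  proof eventually_elim
    case (elim x)
    have "(INF r. if W x \<in> C r then ereal (real_of_rat r) else \<infinity>) = ereal (Z x)"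
    proof (rule antisym)
      show "ereal (Z x) \<le> (INF r. if W x \<in> C r then ereal (real_of_rat r) else \<infinity>)"
        using elim by (intro INF_greatest) auto
      show "(INF r. if W x \<in> C r then ereal (real_of_rat r) else \<infinity>) \<le> ereal (Z x)"
      proof (rule ereal_le_epsilon2)
        fix e :: real assume "0 < e"
        then obtain r where r: "Z x < real_of_rat r" "real_of_rat r < Z x + e"
          using of_rat_dense[of "Z x" "Z x + e"] by auto
        then have "W x \<in> C r"
          using elim by auto
        then have "(INF r. if W x \<in> C r then ereal (real_of_rat r) else \<infinity>) \<le> ereal (real_of_rat r)"
          by (intro INF_lower2[of r]) auto
        also have "\<dots> \<le> ereal (Z x) + ereal e"
          using r by simp
        finally show "(INF r. if W x \<in> C r then ereal (real_of_rat r) else \<infinity>) \<le> ereal (Z x) + ereal e" .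
      qed
    qed
    then show ?case
      by (simp add: f_def)
  qed
  ultimately show ?thesis
    by blast
qed

section \<open>Conditionally independent copies\<close>

lemma prob_given_cong_AE:
  assumes "prob_space N" "W \<in> borel_measurable N" "E \<in> sets N" "E' \<in> sets N"
    and "AE x in N. x \<in> E \<longleftrightarrow> x \<in> E'"
  shows "AE x in N. prob_given N W E x = prob_given N W E' x"
proof -
  interpret sigma_finite_subalgebra N "vimage_algebra (space N) W borel"
    using assms by (intro sigma_finite_subalgebra_vimage_borel)
  show ?thesis
    unfolding prob_given_def using assms(3-5)
    by (intro real_cond_exp_cong) (auto elim!: eventually_mono simp: indicator_def)
qed

lemma measure_eq_integral_prob_given:
  assumes "prob_space N" "W \<in> borel_measurable N" "E \<in> sets N"
  shows "measure N E = (\<integral>x. prob_given N W E x \<partial>N)"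
proof -
  interpret prob_space N by fact
  interpret sigma_finite_subalgebra N "vimage_algebra (space N) W borel"
    using assms by (intro sigma_finite_subalgebra_vimage_borel)
  have "integrable N (indicator E :: _ \<Rightarrow> real)"
    using assms(3) by (intro integrable_real_indicator) (auto simp: less_top[symmetric])
  from real_cond_exp_int(2)[OF this] show ?thesis
    using assms(3) by (simp add: prob_given_def)
qed

lemma prob_given_vimage:
  assumes "prob_space N" "W \<in> borel_measurable N" "C \<in> sets borel"
  shows "AE x in N. prob_given N W {x \<in> space N. W x \<in> C} x = indicator C (W x)"
proof -
  interpret prob_space N by fact
  interpret sigma_finite_subalgebra N "vimage_algebra (space N) W borel"
    using assms by (intro sigma_finite_subalgebra_vimage_borel)
  let ?E = "{x \<in> space N. W x \<in> C}"
  have "?E = W -` C \<inter> space N"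
    by auto
  then have G: "?E \<in> sets (vimage_algebra (space N) W borel)"
    using assms(3) by (auto intro: in_vimage_algebra)
  then have "?E \<in> sets N"
    using subalg by (auto simp: subalgebra_def)
  then have "integrable N (indicator ?E :: _ \<Rightarrow> real)"
    by (intro integrable_real_indicator) (auto simp: less_top[symmetric])
  then have "AE x in N. prob_given N W ?E x = indicator ?E x"
    unfolding prob_given_def using G by (intro real_cond_exp_F_meas) auto
  then show ?thesis
    using AE_space by eventually_elim (auto simp: indicator_def)
qed

text \<open>A copy that hits a set \<open>A\<close> exactly when the original does makes \<open>P(Z \<in> A | W)\<close> idempotent.\<close>

lemma cond_iid_given_determined:
  fixes W :: "'b \<Rightarrow> 'c::topological_space"
  assumes N: "prob_space N" and W: "W \<in> borel_measurable N"
    and Z[measurable]: "Z \<in> borel_measurable N" and Y'[measurable]: "Y' \<in> borel_measurable N"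
    and iid: "cond_iid_given N W Z Y'" and A[measurable]: "A \<in> sets borel"
    and eq: "AE x in N. Z x \<in> A \<longleftrightarrow> Y' x \<in> A"
  shows "\<exists>C \<in> sets borel. AE x in N. Z x \<in> A \<longleftrightarrow> W x \<in> C"
proof -
  interpret prob_space N by fact
  let ?G = "vimage_algebra (space N) W borel"
  interpret sigma_finite_subalgebra N ?G
    using N W by (rule sigma_finite_subalgebra_vimage_borel)
  interpret finite_measure_subalgebra N ?G
    by unfold_locales (rule subalg)
  let ?E = "{x \<in> space N. Z x \<in> A}" and ?E2 = "{x \<in> space N. Z x \<in> A \<and> Y' x \<in> A}"
  have "AE x in N. prob_given N W ?E2 x = prob_given N W ?E x"
    using eq by (intro prob_given_cong_AE[OF N W]) (auto elim!: eventually_mono)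
  moreover have "AE x in N. prob_given N W ?E2 x = prob_given N W ?E x * prob_given N W ?E x"
    using iid A by (auto simp: cond_iid_given_def)
  ultimately have "AE x in N. prob_given N W ?E x = prob_given N W ?E x * prob_given N W ?E x"
    by eventually_elim simp
  then obtain B where B: "B \<in> sets ?G" "AE x in N. x \<in> ?E \<longleftrightarrow> x \<in> B"
    using indicator_real_cond_exp_idempotent[of ?E] by (auto simp: prob_given_def)
  then obtain C where "C \<in> sets borel" "B = W -` C \<inter> space N"
    by (auto simp: sets_vimage_algebra2)
  moreover from B(2) AE_space have "AE x in N. Z x \<in> A \<longleftrightarrow> W x \<in> C"
    by eventually_elim (use \<open>B = _\<close> in auto)
  ultimately show ?thesis
    by blast
qed

text \<open>For disjoint \<open>A\<close> and \<open>B\<close>, the conditional probability of \<open>Z \<in> A\<close> and \<open>Y' \<in> B\<close> is a product of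
  indicators of the disjoint events \<open>f(W) \<in> A\<close> and \<open>f(W) \<in> B\<close>.\<close>

lemma cond_iid_given_function_disjoint:
  fixes W :: "'b \<Rightarrow> 'c::topological_space"
  assumes N: "prob_space N" and W[measurable]: "W \<in> borel_measurable N"
    and Z[measurable]: "Z \<in> borel_measurable N" and Y'[measurable]: "Y' \<in> borel_measurable N"
    and iid: "cond_iid_given N W Z Y'"
    and f[measurable]: "f \<in> borel_measurable borel" and Zf: "AE x in N. Z x = f (W x)"
    and AB[measurable]: "A \<in> sets borel" "B \<in> sets borel" and disj: "A \<inter> B = {}"
  shows "AE x in N. \<not> (Z x \<in> A \<and> Y' x \<in> B)"
proof -
  interpret prob_space N by fact
  have ind: "AE x in N. prob_given N W {x \<in> space N. Z x \<in> A'} x = indicator A' (f (W x))"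
    if A'[measurable]: "A' \<in> sets borel" for A'
  proof -
    have C: "f -` A' \<in> sets borel"
      using measurable_sets[OF f A'] by simp
    then have [measurable]: "{x \<in> space N. W x \<in> f -` A'} \<in> events"
      by measurable
    have "AE x in N. prob_given N W {x \<in> space N. Z x \<in> A'} x
                   = prob_given N W {x \<in> space N. W x \<in> f -` A'} x"
      using Zf by (intro prob_given_cong_AE[OF N W]) (auto elim!: eventually_mono)
    with prob_given_vimage[OF N W C] show ?thesis
      by eventually_elim (simp add: indicator_def)
  qed
  let ?E = "{x \<in> space N. Z x \<in> A \<and> Y' x \<in> B}"
  have "AE x in N. prob_given N W ?E x
      = prob_given N W {x \<in> space N. Z x \<in> A} x * prob_given N W {x \<in> space N. Z x \<in> B} x"
    using iid AB by (auto simp: cond_iid_given_def)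
  with ind[OF AB(1)] ind[OF AB(2)] have "AE x in N. prob_given N W ?E x = 0"
    by eventually_elim (use disj in \<open>auto simp: indicator_def\<close>)
  then have "measure N ?E = 0"
    by (subst measure_eq_integral_prob_given[OF N W]) (auto intro: integral_eq_zero_AE)
  then have "?E \<in> null_sets N"
    by (auto simp: null_sets_def emeasure_eq_measure)
  from AE_not_in[OF this] AE_space show ?thesis
    by eventually_elim auto
qed

lemma cond_iid_given_function_eq:
  fixes W :: "'b \<Rightarrow> 'c::topological_space"
  assumes "prob_space N" "W \<in> borel_measurable N" "Z \<in> borel_measurable N"
    "Y' \<in> borel_measurable N" "cond_iid_given N W Z Y'"
    "f \<in> borel_measurable borel" "AE x in N. Z x = f (W x)"
  shows "AE x in N. Z x = Y' x"
proof -
  note sep = cond_iid_given_function_disjoint[OF assms]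
  have "AE x in N. \<not> (Z x \<in> {..real_of_rat r} \<and> Y' x \<in> {real_of_rat r<..})"
    and "AE x in N. \<not> (Z x \<in> {real_of_rat r<..} \<and> Y' x \<in> {..real_of_rat r})" for r
    by (rule sep; auto)+
  then have "AE x in N. \<forall>r. \<not> (Z x \<le> real_of_rat r \<and> real_of_rat r < Y' x)"
    and "AE x in N. \<forall>r. \<not> (real_of_rat r < Z x \<and> Y' x \<le> real_of_rat r)"
    by (simp_all add: AE_all_countable)
  then show ?thesis
  proof eventually_elim
    case (elim x)
    then show ?case
      using of_rat_dense[of "Z x" "Y' x"] of_rat_dense[of "Y' x" "Z x"]
      by (meson less_imp_le linorder_neqE_linordered_idom)
  qed
qed

section \<open>The characterisation of perfect dependence\<close>

text \<open>Perfect dependence concerns only the joint law of \<open>(X, Y)\<close>, so it can be read off on an extension.\<close>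

lemma perfectly_dependent_extension_iff:
  fixes X :: "'a \<Rightarrow> 'c::topological_space"
  assumes ext: "prob_extension M N p"
    and [measurable]: "X \<in> borel_measurable M" "Y \<in> borel_measurable M"
  shows "perfectly_dependent M X Y \<longleftrightarrow> perfectly_dependent N (X \<circ> p) (Y \<circ> p)"
proof -
  have p: "p \<in> measurable N M" "distr N M p = M"
    using ext by (auto simp: prob_extension_def)
  have "(AE x in M. Y x = f (X x)) \<longleftrightarrow> (AE x in N. Y (p x) = f (X (p x)))"
    if [measurable]: "f \<in> borel_measurable borel" for f
  proof -
    have "{x \<in> space M. Y x = f (X x)} \<in> sets M"
      by measurable
    from AE_distr_iff[OF p(1) this] show ?thesis
      unfolding p(2) .
  qed
  then show ?thesis
    by (auto simp: perfectly_dependent_def)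
qed

theorem theorem2p6:
  fixes M :: "'a measure" and N :: "'b measure" and p :: "'b \<Rightarrow> 'a"
    and X :: "'a \<Rightarrow> real ^ 'd" and Y :: "'a \<Rightarrow> real" and Y' :: "'b \<Rightarrow> real"
  assumes "prob_space M"
    and "X \<in> borel_measurable M"
    and "Y \<in> borel_measurable M"
    and "cond_iid_copy M X Y N p Y'"
    and "continuous_on UNIV (cdf (distr M borel Y))"
  shows "(\<exists>t\<in>{0<..1}. kappa M Y N p Y' t = 1) \<longleftrightarrow> perfectly_dependent M X Y"
proof -
  let ?F = "cdf (distr M borel Y)" and ?W = "X \<circ> p" and ?Z = "Y \<circ> p"
  let ?D = "\<lambda>\<omega>. \<bar>?F (Y (p \<omega>)) - ?F (Y' \<omega>)\<bar>"
  have ext: "prob_extension M N p" and Y'[measurable]: "Y' \<in> borel_measurable N"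
    and iid: "cond_iid_given N ?W ?Z Y'"
    using assms(4) by (auto simp: cond_iid_copy_def)
  then have N: "prob_space N" and p[measurable]: "p \<in> measurable N M" and distr: "distr N M p = M"
    by (auto simp: prob_extension_def)
  have W[measurable]: "?W \<in> borel_measurable N" and Z[measurable]: "?Z \<in> borel_measurable N"
    using assms(2,3) p by auto
  interpret N: prob_space N by fact
  interpret \<mu>: real_distribution "distr M borel Y"
    using prob_space.real_distribution_distr[OF assms(1)] assms(3) by simp
  have F[measurable]: "?F \<in> borel_measurable borel"
    using borel_measurable_continuous_onI[OF assms(5)] .
  have D: "?D \<in> borel_measurable N"
    using assms(3) by measurable
  have kappa: "kappa M Y N p Y' t = 1 \<longleftrightarrow> (AE \<omega> in N. ?F (?Z \<omega>) = ?F (Y' \<omega>))" if "t > 0" for t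
    using N.integral_tail_eq_0_iff[OF D _ that] by (simp add: kappa_def phi_def Let_def)
  have "perfectly_dependent N ?W ?Z" if eq: "AE \<omega> in N. ?F (?Z \<omega>) = ?F (Y' \<omega>)"
    unfolding perfectly_dependent_def
  proof (rule AE_eq_function_if_levels_determined)
    fix r :: rat
    let ?A = "{y. ?F y \<le> ?F (real_of_rat r)}"
    have A: "?A \<in> sets borel"
      by measurable
    have "AE \<omega> in N. ?Z \<omega> \<in> ?A \<longleftrightarrow> Y' \<omega> \<in> ?A"
      using eq by eventually_elim simp
    then obtain C where C: "C \<in> sets borel" "AE \<omega> in N. ?Z \<omega> \<in> ?A \<longleftrightarrow> ?W \<omega> \<in> C"
      using cond_iid_given_determined[OF N W Z Y' iid A] by blast
    have "AE x in distr N M p. ?F (Y x) \<le> ?F (real_of_rat r) \<longleftrightarrow> Y x \<le> real_of_rat r"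
      unfolding distr using AE_distrD[OF assms(3) \<mu>.AE_cdf_le_iff[OF assms(5)]] .
    from AE_distrD[OF p this]
    have "AE \<omega> in N. ?F (?Z \<omega>) \<le> ?F (real_of_rat r) \<longleftrightarrow> ?Z \<omega> \<le> real_of_rat r"
      by simp
    with C(2) have "AE \<omega> in N. ?Z \<omega> \<le> real_of_rat r \<longleftrightarrow> ?W \<omega> \<in> C"
      by eventually_elim simp
    with C(1) show "\<exists>C\<in>sets borel. AE \<omega> in N. ?Z \<omega> \<le> real_of_rat r \<longleftrightarrow> ?W \<omega> \<in> C"
      by blast
  qed
  moreover have "AE \<omega> in N. ?F (?Z \<omega>) = ?F (Y' \<omega>)" if "perfectly_dependent N ?W ?Z"
  proof -
    from that obtain f where "f \<in> borel_measurable borel" "AE \<omega> in N. ?Z \<omega> = f (?W \<omega>)"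
      by (auto simp: perfectly_dependent_def)
    from cond_iid_given_function_eq[OF N W Z Y' iid this] show ?thesis
      by eventually_elim simp
  qed
  moreover have "(\<exists>t\<in>{0<..1}. kappa M Y N p Y' t = 1) \<longleftrightarrow> (AE \<omega> in N. ?F (?Z \<omega>) = ?F (Y' \<omega>))"
    by (metis greaterThanAtMost_iff kappa order_refl zero_less_one)
  ultimately show ?thesis
    using perfectly_dependent_extension_iff[OF ext assms(2,3)] by blast
qed

end
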